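(* The cost $\mathfrak C_{app}$ of computing $\mathbf v=\mathtt A\mathbf u$ by the matrix-free sum factorization algorithm described in the context (excluding the evaluation of $u(\mathbf x)\mathcal F(\mathbf x)$ at the quadrature points) satisfies $$\mathfrak C_{app}\eqsim\sum_{i=1}^d q_i\Big(\prod_{\delta=i}^d\#\mathbb X_\delta\Big)\prod_{\delta=1}^{i-1}M_\delta\le\sum_{i=1}^d q_i\,\#\mathbb X_d\prod_{\delta=1}^{d-1}\max\{\#\mathbb X_\delta,M_\delta\}.$$ The overall cost is bounded as follows, with $p:=\max\{p_1,\dots,p_d,q_1,\dots,q_d\}$: 1. if $\#\mathbb X_\delta\lesssim pM_\delta$ for all $\delta$, then $\mathfrak C_{app}\lesssim p^{d+1}M$; 2. if $\#\mathbb X_\delta\lesssim M_\delta$ for all $\delta$, then $\mathfrak C_{app}\lesssim p\,M$; 3. if $\#\mathbb X_\delta\gtrsim M_\delta$ for all $\delta$, then $\mathfrak C_{app}\lesssim p\,\#\mathbb X$.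
   Context: Tensor-product setting. For each direction $\delta=1,\dots,d$ let $\Phi_\delta=(\phi^{(\delta)}_n)_{n=1}^{N_\delta}$ and $\Psi_\delta=(\psi^{(\delta)}_m)_{m=1}^{M_\delta}$ be finite families of univariate real functions, $\mathbb X_\delta\subset\mathbb R$ a finite set of quadrature points and $\omega_\delta:\mathbb X_\delta\to\mathbb R$ weights. Put $N=\prod_\delta N_\delta$, $M=\prod_\delta M_\delta$, $\mathbb X=\mathbb X_1\times\dots\times\mathbb X_d$, $\omega(\mathbf x)=\prod_\delta\omega_\delta(x_\delta)$. The families $\Phi=(\phi_n)_{n=1}^N$, $\Psi=(\psi_m)_{m=1}^M$ consist of all products $\phi_n(\mathbf x)=\prod_\delta\phi^{(\delta)}_{n_\delta}(x_\delta)$ and $\psi_m(\mathbf x)=\prod_\delta\psi^{(\delta)}_{m_\delta}(x_\delta)$, ordered lexicographically (first index running fastest). For a coefficient $\mathcal F:\mathbb X\to\mathbb R$, let $\mathtt a(\phi,\psi)=\sum_{\mathbf x\in\mathbb X}\omega(\mathbf x)\mathcal F(\mathbf x)\phi(\mathbf x)\psi(\mathbf x)$ and let $\mathtt A$ be the $M\times N$ matrix with entries $\mathtt a(\phi_n,\psi_m)$ (row $m$, column $n$). For $\mathbf u\in\mathbb R^N$ put $u(\mathbf x)=\sum_{n=1}^N\mathbf u_n\phi_n(\mathbf x)$. Overlap parameters. $\mathrm{csupp}\,\phi:=\{\alpha\mathbf x+(1-\alpha)\mathbf y:\phi(\mathbf x)\ne0,\ \phi(\mathbf y)\neq 0,\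 \alpha\in[0,1]\}$, $p_\delta=\max_{x\in\mathbb X_\delta}\#\{\phi\in\Phi_\delta:x\in\mathrm{csupp}\,\phi\}$, $q_\delta=\max_{x\in\mathbb X_\delta}\#\{\psi\in\Psi_\delta:x\in\mathrm{csupp}\,\psi\}$. Algorithm APPLY$_d$ (input: $\mathbb X_\delta,\omega_\delta,\Psi_\delta$ for $\delta\le d$, and the values of $\mathcal F u$ on $\mathbb X$). If $d=0$, return the single value of $\mathcal Fu$. Otherwise start from the zero vector $\mathbf v$ of length $M$, split into $M_d$ consecutive blocks $\mathbf w_{m_d}$ of length $\prod_{\delta<d}M_\delta$. For each $x_d\in\mathbb X_d$: compute recursively $\mathbf v_{x_d}$ by APPLY$_{d-1}$ on the first $d-1$ directions with data $(\mathcal Fu)(\cdot,x_d)$; then for all $m_d$ with $\psi^{(d)}_{m_d}(x_d)\ne0$ update $\mathbf w_{m_d}\leftarrow\mathbf w_{m_d}+\omega_d(x_d)\psi^{(d)}_{m_d}(x_d)\mathbf v_{x_d}$. Return $\mathbf v$. Cost. $\mathfrak C_{app}$ is the computational cost (number of arithmetic operations) of this algorithm; the values of the functions $\psi^{(\delta)}_m$ and of $\mathcal F u$ at the quadrature points are assumed to be already available. The number of iterations of the loop over $m_d$ for each $x_d$ is bounded by $q_d$, and this factor enters the cost formula. Notation: $a\lesssim b$ means $a\le c\,b$ with $c>0$ independent of all $p_\delta,q_\delta,N_\delta,M_\delta,\mathbb X_\delta$ but possibly depending on $d$; $a\gtrsim b$ means $b\lesssim a$; $a\eqsim b$ means $a\lesssim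 b$ and $b\lesssim a$. $\#T$ is the number of elements of $T$. Empty products equal $1$. *)

theory Defs
  imports Complex_Main "HOL-Library.FuncSet" "Jordan_Normal_Form.Matrix"
begin

text \<open>
  Directions are numbered \<open>1, \<dots>, d\<close>; basis functions and vector entries are numbered from \<open>0\<close>,
  as in the matrix library. A direction-indexed family is a function on \<open>nat\<close>, of which only the
  values on \<open>{1..d}\<close> matter, and a point of the tensor-product grid is an extensional function
  on \<open>{1..d}\<close>.
\<close>

definition grid :: "nat \<Rightarrow> (nat \<Rightarrow> real set) \<Rightarrow> (nat \<Rightarrow> real) set" where
  "grid d X = PiE {1..d} X"

definition tensor_weight :: "nat \<Rightarrow> (nat \<Rightarrow> real \<Rightarrow> real) \<Rightarrow> (nat \<Rightarrow> real) \<Rightarrow> real" where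
  "tensor_weight d \<omega> x = (\<Prod>\<delta>=1..d. \<omega> \<delta> (x \<delta>))"

text \<open>
  Lexicographic ordering with the first index running fastest: the flat index is
  \<open>n = (\<Sum>\<delta>=1..d. n\<^sub>\<delta> * (\<Prod>\<epsilon>=1..<\<delta>. N \<epsilon>))\<close> with \<open>n\<^sub>\<delta> < N \<delta>\<close>.
\<close>

definition multi_index :: "(nat \<Rightarrow> nat) \<Rightarrow> nat \<Rightarrow> nat \<Rightarrow> nat" where
  "multi_index N n \<delta> = (n div (\<Prod>\<epsilon>=1..<\<delta>. N \<epsilon>)) mod N \<delta>"

definition tensor_fun ::
  "nat \<Rightarrow> (nat \<Rightarrow> nat) \<Rightarrow> (nat \<Rightarrow> nat \<Rightarrow> real \<Rightarrow> real) \<Rightarrow> nat \<Rightarrow> (nat \<Rightarrow> real) \<Rightarrow> real" where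
  "tensor_fun d N \<Phi> n x = (\<Prod>\<delta>=1..d. \<Phi> \<delta> (multi_index N n \<delta>) (x \<delta>))"

definition quad_form ::
  "nat \<Rightarrow> (nat \<Rightarrow> real set) \<Rightarrow> (nat \<Rightarrow> real \<Rightarrow> real) \<Rightarrow> ((nat \<Rightarrow> real) \<Rightarrow> real) \<Rightarrow>
   ((nat \<Rightarrow> real) \<Rightarrow> real) \<Rightarrow> ((nat \<Rightarrow> real) \<Rightarrow> real) \<Rightarrow> real" where
  "quad_form d X \<omega> F \<phi> \<psi> = (\<Sum>x\<in>grid d X. tensor_weight d \<omega> x * F x * \<phi> x * \<psi> x)"

definition sys_matrix ::
  "nat \<Rightarrow> (nat \<Rightarrow> real set) \<Rightarrow> (nat \<Rightarrow> real \<Rightarrow> real) \<Rightarrow> ((nat \<Rightarrow> real) \<Rightarrow> real) \<Rightarrow>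
   (nat \<Rightarrow> nat) \<Rightarrow> (nat \<Rightarrow> nat \<Rightarrow> real \<Rightarrow> real) \<Rightarrow>
   (nat \<Rightarrow> nat) \<Rightarrow> (nat \<Rightarrow> nat \<Rightarrow> real \<Rightarrow> real) \<Rightarrow> real mat" where
  "sys_matrix d X \<omega> F N \<Phi> M \<Psi> =
     mat (\<Prod>\<delta>=1..d. M \<delta>) (\<Prod>\<delta>=1..d. N \<delta>)
       (\<lambda>(m, n). quad_form d X \<omega> F (tensor_fun d N \<Phi> n) (tensor_fun d M \<Psi> m))"

definition lin_comb ::
  "nat \<Rightarrow> (nat \<Rightarrow> nat) \<Rightarrow> (nat \<Rightarrow> nat \<Rightarrow> real \<Rightarrow> real) \<Rightarrow> real vec \<Rightarrow> (nat \<Rightarrow> real) \<Rightarrow> real" where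
  "lin_comb d N \<Phi> u x = (\<Sum>n<(\<Prod>\<delta>=1..d. N \<delta>). u $ n * tensor_fun d N \<Phi> n x)"

definition csupp :: "('a::real_vector \<Rightarrow> real) \<Rightarrow> 'a set" where
  "csupp \<phi> = {\<alpha> *\<^sub>R x + (1 - \<alpha>) *\<^sub>R y |\<alpha> x y. \<phi> x \<noteq> 0 \<and> \<phi> y \<noteq> 0 \<and> 0 \<le> \<alpha> \<and> \<alpha> \<le> 1}"

text \<open>Members of a family are counted by index, so a repeated function counts repeatedly.\<close>

definition overlap :: "real set \<Rightarrow> nat \<Rightarrow> (nat \<Rightarrow> real \<Rightarrow> real) \<Rightarrow> nat" where
  "overlap S K \<phi> = Max ((\<lambda>x. card {k. k < K \<and> x \<in> csupp (\<phi> k)}) ` S)"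

definition max_overlap ::
  "nat \<Rightarrow> (nat \<Rightarrow> real set) \<Rightarrow> (nat \<Rightarrow> nat) \<Rightarrow> (nat \<Rightarrow> nat \<Rightarrow> real \<Rightarrow> real) \<Rightarrow>
   (nat \<Rightarrow> nat) \<Rightarrow> (nat \<Rightarrow> nat \<Rightarrow> real \<Rightarrow> real) \<Rightarrow> nat" where
  "max_overlap d X N \<Phi> M \<Psi> =
     Max ((\<lambda>\<delta>. overlap (X \<delta>) (N \<delta>) (\<Phi> \<delta>)) ` {1..d} \<union>
          (\<lambda>\<delta>. overlap (X \<delta>) (M \<delta>) (\<Psi> \<delta>)) ` {1..d})"

text \<open>
  Computations with an operation counter: the second component of a pair is the number of
  arithmetic operations spent on producing the first.
\<close>

definition cbind :: "'a \<times> nat \<Rightarrow> ('a \<Rightarrow> 'b \<times> nat) \<Rightarrow> 'b \<times> nat" where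
  "cbind r f = (fst (f (fst r)), snd r + snd (f (fst r)))"

primrec cloop :: "('b \<Rightarrow> 'a \<Rightarrow> 'a \<times> nat) \<Rightarrow> 'b list \<Rightarrow> 'a \<Rightarrow> 'a \<times> nat" where
  "cloop f [] v = (v, 0)"
| "cloop f (x # xs) v = cbind (f x v) (cloop f xs)"

definition cmult :: "real \<Rightarrow> real \<Rightarrow> real \<times> nat" where
  "cmult a b = (a * b, 1)"

definition cscale :: "real \<Rightarrow> real vec \<Rightarrow> real vec \<times> nat" where
  "cscale a w = (a \<cdot>\<^sub>v w, dim_vec w)"

text \<open>Add \<open>w\<close> to the \<open>m\<close>-th of the consecutive blocks of length \<open>dim_vec w\<close> of \<open>v\<close>.\<close>

definition cadd_block :: "nat \<Rightarrow> real vec \<Rightarrow> real vec \<Rightarrow> real vec \<times> nat" where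
  "cadd_block m w v =
     (vec (dim_vec v)
        (\<lambda>i. if m * dim_vec w \<le> i \<and> i < Suc m * dim_vec w
             then v $ i + w $ (i - m * dim_vec w) else v $ i),
      dim_vec w)"

text \<open>
  The argument \<open>g\<close> supplies the values of \<open>F * u\<close> on the grid; function values are looked up at no
  cost. The points of each direction are visited in increasing order, which affects neither the
  (exact) result nor the count.
\<close>

primrec apply_alg ::
  "nat \<Rightarrow> (nat \<Rightarrow> real set) \<Rightarrow> (nat \<Rightarrow> real \<Rightarrow> real) \<Rightarrow> (nat \<Rightarrow> nat) \<Rightarrow>
   (nat \<Rightarrow> nat \<Rightarrow> real \<Rightarrow> real) \<Rightarrow> ((nat \<Rightarrow> real) \<Rightarrow> real) \<Rightarrow> real vec \<times> nat" where
  "apply_alg 0 X \<omega> M \<Psi> g = (vec 1 (\<lambda>_. g (\<lambda>_. undefined)), 0)"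
| "apply_alg (Suc d) X \<omega> M \<Psi> g =
     cloop
       (\<lambda>x v.
          cbind (apply_alg d X \<omega> M \<Psi> (\<lambda>y. g (y(Suc d := x)))) (\<lambda>vx.
          cloop
            (\<lambda>m v'.
               cbind (cmult (\<omega> (Suc d) x) (\<Psi> (Suc d) m x)) (\<lambda>s.
               cbind (cscale s vx) (\<lambda>w.
               cadd_block m w v')))
            (filter (\<lambda>m. \<Psi> (Suc d) m x \<noteq> 0) [0..<M (Suc d)])
            v))
       (sorted_list_of_set (X (Suc d)))
       (0\<^sub>v (\<Prod>\<delta>=1..Suc d. M \<delta>))"

text \<open>
  Cost in terms of the size parameters: the largest number of operations over all inputs on the
  grid given by \<open>X\<close> with family sizes \<open>M\<close> and overlaps \<open>q\<close>. (For a single input, the number of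
  passes of the inner loop at a point \<open>x\<close> is only bounded by \<open>q \<delta>\<close>; it is \<open>0\<close> if all functions of
  that direction vanish at \<open>x\<close>, so no lower bound in terms of \<open>q\<close> holds for each input.)
\<close>

definition cost_app :: "nat \<Rightarrow> (nat \<Rightarrow> real set) \<Rightarrow> (nat \<Rightarrow> nat) \<Rightarrow> (nat \<Rightarrow> nat) \<Rightarrow> nat" where
  "cost_app d X M q =
     Sup {snd (apply_alg d X \<omega> M \<Psi> g) |\<omega> \<Psi> g.
            \<forall>\<delta>\<in>{1..d}. overlap (X \<delta>) (M \<delta>) (\<Psi> \<delta>) = q \<delta>}"

definition admissible :: "nat \<Rightarrow> (nat \<Rightarrow> real set) \<Rightarrow> (nat \<Rightarrow> nat) \<Rightarrow> (nat \<Rightarrow> nat) \<Rightarrow> bool" where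
  "admissible d X N M \<longleftrightarrow>
     (\<forall>\<delta>\<in>{1..d}. finite (X \<delta>) \<and> X \<delta> \<noteq> {} \<and> 1 \<le> N \<delta> \<and> 1 \<le> M \<delta>)"

end

theory Submission
  imports Defs
begin

text \<open>
  One call of the algorithm in direction \<open>i\<close> makes, for each point \<open>x\<close> of that direction, a
  recursive call and, for each function that does not vanish at \<open>x\<close>, one product of scalars
  together with a scaling and an addition of a vector of length \<open>L i = (\<Prod>\<delta>=1..<i. M \<delta>)\<close>.
  Direction \<open>i\<close> is reached once for each choice of points in the directions above it. Unrolling the
  recursion gives a closed formula for the number of operations in which the data enter only through
  the numbers of nonvanishing functions (\<open>apply_alg_cost\<close>). Since a function that is nonzero at
  \<open>x\<close> has \<open>x\<close> in its convex support, there are at most \<open>q i\<close> of these functions at each point, and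
  \<open>1 + 2 * L i\<close> lies between \<open>2 * L i\<close> and \<open>3 * L i\<close>. Hence, with \<open>S\<close> the sum in the theorem
  (called \<open>work\<close> below), every input costs at most \<open>3 * S\<close> (\<open>apply_alg_cost_le\<close>). Families whose
  first \<open>q i\<close> members are constantly one and whose other members vanish have \<open>q i\<close> nonvanishing
  functions at every point, so they cost at least \<open>2 * S\<close> (\<open>cost_app_ge\<close>).

  Correctness (\<open>apply_alg_value\<close>) is the interchange of sum and product over the grid: the flat
  index \<open>k\<close> splits into the block \<open>k div L d\<close>, which is the index in the last direction, and the
  position \<open>k mod L d\<close> in that block, which is the flat index in the other directions.

  The remaining estimates all come from replacing every factor \<open>card (X \<delta>)\<close> and \<open>M \<delta>\<close> in a
  summand of \<open>S\<close> by a common upper bound \<open>B \<delta>\<close> (\<open>prod_switch_le\<close>), so that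
  \<open>S \<le> d * p * (\<Prod>\<delta>=1..d. B \<delta>)\<close>. The three regimes correspond to
  \<open>B \<delta> = k * p * M \<delta>\<close>, \<open>B \<delta> = k * M \<delta>\<close> and \<open>B \<delta> = k * card (X \<delta>)\<close>. Here
  \<open>k = max 1 K\<close>, because \<open>B \<delta>\<close> has to dominate both factors and the constant \<open>K\<close> may be below \<open>1\<close>.
\<close>

section \<open>Loops with an operation counter\<close>

lemma fst_cbind [simp]: "fst (cbind r f) = fst (f (fst r))"
  and snd_cbind [simp]: "snd (cbind r f) = snd r + snd (f (fst r))"
  by (simp_all add: cbind_def)

lemma fst_cmult [simp]: "fst (cmult a b) = a * b" and snd_cmult [simp]: "snd (cmult a b) = 1"
  by (simp_all add: cmult_def)

lemma fst_cscale [simp]: "fst (cscale a w) = a \<cdot>\<^sub>v w"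
  and snd_cscale [simp]: "snd (cscale a w) = dim_vec w"
  by (simp_all add: cscale_def)

lemma dim_cadd_block [simp]: "dim_vec (fst (cadd_block m w v)) = dim_vec v"
  and snd_cadd_block [simp]: "snd (cadd_block m w v) = dim_vec w"
  by (simp_all add: cadd_block_def)

lemma in_block_iff:
  fixes i m L :: nat
  assumes "0 < L"
  shows "m * L \<le> i \<and> i < Suc m * L \<longleftrightarrow> i div L = m"
  using assms less_eq_div_iff_mult_less_eq[of L m i] div_less_iff_less_mult[of L i "Suc m"]
  by linarith

lemma index_cadd_block:
  assumes "0 < dim_vec w" and "i < dim_vec v"
  shows "fst (cadd_block m w v) $ i =
    v $ i + (if i div dim_vec w = m then w $ (i mod dim_vec w) else 0)"
proof -
  have "i - m * dim_vec w = i mod dim_vec w" if "i div dim_vec w = m"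
    using that by (metis minus_div_mult_eq_mod)
  then show ?thesis
    using in_block_iff[OF assms(1), of m i] assms(2) unfolding cadd_block_def by auto
qed

lemma snd_cloop:
  assumes "\<And>x v. x \<in> set xs \<Longrightarrow> snd (f x v) = c x"
  shows "snd (cloop f xs v) = (\<Sum>x\<leftarrow>xs. c x)"
  using assms by (induction xs arbitrary: v) auto

lemma dim_cloop:
  assumes "\<And>x v. dim_vec (fst (f x v)) = dim_vec v"
  shows "dim_vec (fst (cloop f xs v)) = dim_vec v"
  by (induction xs arbitrary: v) (simp_all add: assms)

text \<open>
  Both loops of the algorithm have this form: the increment \<open>h x\<close> of a fixed entry does not depend
  on the accumulator, so the order of the passes is irrelevant and the loop is a sum.
\<close>

lemma index_cloop:
  fixes v :: "'a::comm_monoid_add vec"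
  assumes "\<And>x v. dim_vec (fst (f x v)) = dim_vec v"
    and "\<And>x v. x \<in> set xs \<Longrightarrow> dim_vec v = n \<Longrightarrow> fst (f x v) $ i = v $ i + h x"
    and "dim_vec v = n"
  shows "fst (cloop f xs v) $ i = v $ i + (\<Sum>x\<leftarrow>xs. h x)"
  using assms(2,3) by (induction xs arbitrary: v) (simp_all add: assms(1) ac_simps)

section \<open>The algorithm computes the matrix-vector product\<close>

text \<open>
  The inner loop of the algorithm. The parameters are the weight \<open>a\<close> and the \<open>K\<close> function values \<open>\<psi>\<close>
  at one point of the last direction, the result \<open>w\<close> of the recursive call for this point, and the
  accumulator \<open>v\<close>.
\<close>

definition add_point :: "real \<Rightarrow> (nat \<Rightarrow> real) \<Rightarrow> nat \<Rightarrow> real vec \<Rightarrow> real vec \<Rightarrow> real vec \<times> nat" where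
  "add_point a \<psi> K w v =
     cloop (\<lambda>m v'. cbind (cmult a (\<psi> m)) (\<lambda>s. cbind (cscale s w) (\<lambda>w'. cadd_block m w' v')))
       (filter (\<lambda>m. \<psi> m \<noteq> 0) [0..<K]) v"

lemma apply_alg_Suc:
  "apply_alg (Suc d) X \<omega> M \<Psi> g =
     cloop
       (\<lambda>x v. cbind (apply_alg d X \<omega> M \<Psi> (\<lambda>y. g (y(Suc d := x))))
          (\<lambda>w. add_point (\<omega> (Suc d) x) (\<lambda>m. \<Psi> (Suc d) m x) (M (Suc d)) w v))
       (sorted_list_of_set (X (Suc d))) (0\<^sub>v (\<Prod>\<delta>=1..Suc d. M \<delta>))"
  by (simp add: add_point_def)

lemma dim_add_point [simp]: "dim_vec (fst (add_point a \<psi> K w v)) = dim_vec v"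
  unfolding add_point_def by (rule dim_cloop) simp

lemma snd_add_point:
  "snd (add_point a \<psi> K w v) = card {m. m < K \<and> \<psi> m \<noteq> 0} * (1 + 2 * dim_vec w)"
proof -
  have "snd (add_point a \<psi> K w v) = (\<Sum>m\<leftarrow>filter (\<lambda>m. \<psi> m \<noteq> 0) [0..<K]. 1 + 2 * dim_vec w)"
    unfolding add_point_def by (rule snd_cloop) simp
  also have "\<dots> = length (filter (\<lambda>m. \<psi> m \<noteq> 0) [0..<K]) * (1 + 2 * dim_vec w)"
    by (simp add: sum_list_triv)
  also have "length (filter (\<lambda>m. \<psi> m \<noteq> 0) [0..<K]) = card {m. m < K \<and> \<psi> m \<noteq> 0}"
  proof -
    have "length (filter (\<lambda>m. \<psi> m \<noteq> 0) [0..<K]) = card (set (filter (\<lambda>m. \<psi> m \<noteq> 0) [0..<K]))"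
      by (rule distinct_card[symmetric]) simp
    also have "set (filter (\<lambda>m. \<psi> m \<noteq> 0) [0..<K]) = {m. m < K \<and> \<psi> m \<noteq> 0}"
      by auto
    finally show ?thesis .
  qed
  finally show ?thesis .
qed

lemma index_add_point:
  assumes "i < dim_vec v" and "dim_vec v = K * dim_vec w"
  shows "fst (add_point a \<psi> K w v) $ i =
    v $ i + a * \<psi> (i div dim_vec w) * w $ (i mod dim_vec w)"
proof -
  define L where "L = dim_vec w"
  have L: "0 < L" using assms unfolding L_def by (cases "dim_vec w") auto
  have iK: "i div L < K" using assms L unfolding L_def by (simp add: div_less_iff_less_mult)
  let ?ms = "filter (\<lambda>m. \<psi> m \<noteq> 0) [0..<K]"
  let ?h = "\<lambda>m. if i div L = m then a * \<psi> m * w $ (i mod L) else 0"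
  have "fst (add_point a \<psi> K w v) $ i = v $ i + (\<Sum>m\<leftarrow>?ms. ?h m)"
    unfolding add_point_def
    by (rule index_cloop[where n = "dim_vec v"]) (use L assms(1) in \<open>auto simp: index_cadd_block L_def\<close>)
  also have "(\<Sum>m\<leftarrow>?ms. ?h m) = (\<Sum>m\<in>set ?ms. ?h m)"
    by (rule sum_list_distinct_conv_sum_set) simp
  also have "\<dots> = a * \<psi> (i div L) * w $ (i mod L)"
    using iK by (simp add: sum.delta)
  finally show ?thesis unfolding L_def .
qed

lemma prod_Suc_atLeastAtMost:
  "(\<Prod>\<delta>=1..Suc d. f \<delta>) = (\<Prod>\<delta>=1..d. f \<delta>) * (f (Suc d) :: 'a::comm_monoid_mult)"
  by simp

text \<open>
  The weights of the digits in a mixed-radix expansion divide each other, so the digits below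
  position \<open>d\<close> depend on the index modulo the \<open>d\<close>-th weight only.
\<close>

lemma multi_index_mod:
  assumes "\<delta> \<in> {1..d}"
  shows "multi_index M (i mod (\<Prod>\<epsilon>=1..d. M \<epsilon>)) \<delta> = multi_index M i \<delta>"
proof -
  define P where "P = (\<Prod>\<epsilon>=1..<\<delta>. M \<epsilon>)"
  define R where "R = (\<Prod>\<epsilon>\<in>{Suc \<delta>..d}. M \<epsilon>)"
  have "{1..d} = {1..<\<delta>} \<union> {\<delta>..d}" "{\<delta>..d} = insert \<delta> {Suc \<delta>..d}"
    using assms by auto
  then have "(\<Prod>\<epsilon>=1..d. M \<epsilon>) = P * (M \<delta> * R)"
    unfolding P_def R_def by (subst \<open>{1..d} = _\<close>, subst prod.union_disjoint) auto
  then have "(i mod (\<Prod>\<epsilon>=1..d. M \<epsilon>)) div P = (if P = 0 then 0 else (i div P) mod (M \<delta> * R))"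
    by (simp add: mod_mult2_eq)
  then show ?thesis
    unfolding multi_index_def P_def[symmetric]
    by (auto simp: mod_mod_cancel)
qed

lemma tensor_fun_Suc:
  assumes "i < (\<Prod>\<delta>=1..Suc d. M \<delta>)"
  shows "tensor_fun (Suc d) M \<Psi> i (y(Suc d := x)) =
    tensor_fun d M \<Psi> (i mod (\<Prod>\<delta>=1..d. M \<delta>)) y * \<Psi> (Suc d) (i div (\<Prod>\<delta>=1..d. M \<delta>)) x"
proof -
  have "i div (\<Prod>\<delta>=1..d. M \<delta>) < M (Suc d)"
    using assms unfolding prod_Suc_atLeastAtMost
    by (metis less_mult_imp_div_less mult.commute)
  then have "multi_index M i (Suc d) = i div (\<Prod>\<delta>=1..d. M \<delta>)"
    by (simp add: multi_index_def atLeastLessThanSuc_atLeastAtMost)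
  then show ?thesis
    unfolding tensor_fun_def prod_Suc_atLeastAtMost
    by (auto simp del: One_nat_def simp: multi_index_mod intro!: prod.cong)
qed

lemma tensor_weight_Suc:
  "tensor_weight (Suc d) \<omega> (y(Suc d := x)) = tensor_weight d \<omega> y * \<omega> (Suc d) x"
  unfolding tensor_weight_def prod_Suc_atLeastAtMost by (auto intro!: prod.cong)

lemma sum_grid_Suc:
  "(\<Sum>z\<in>grid (Suc d) X. f z) = (\<Sum>x\<in>X (Suc d). \<Sum>y\<in>grid d X. f (y(Suc d := x)))"
proof -
  have "grid (Suc d) X = (\<lambda>(x, y). y(Suc d := x)) ` (X (Suc d) \<times> grid d X)"
    unfolding grid_def by (subst atLeastAtMostSuc_conv) (simp_all add: PiE_insert_eq)
  moreover have "inj_on (\<lambda>(x, y). y(Suc d := x)) (X (Suc d) \<times> grid d X)"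
    unfolding grid_def by (rule inj_combinator) simp
  ultimately show ?thesis
    by (simp add: sum.reindex sum.cartesian_product case_prod_unfold)
qed

text \<open>
  Stated for all values \<open>g\<close> on the grid rather than for \<open>F * u\<close> only, because the recursive calls
  work with the restrictions of \<open>g\<close> to slices.
\<close>

lemma apply_alg_value:
  assumes "\<forall>\<delta>\<in>{1..d}. finite (X \<delta>)"
  shows "fst (apply_alg d X \<omega> M \<Psi> g) =
    vec (\<Prod>\<delta>=1..d. M \<delta>)
      (\<lambda>i. \<Sum>x\<in>grid d X. tensor_weight d \<omega> x * g x * tensor_fun d M \<Psi> i x)"
  using assms
proof (induction d arbitrary: g)
  case 0
  show ?case by (rule eq_vecI) (simp_all add: grid_def tensor_weight_def tensor_fun_def)
next
  case (Suc d)
  define L where "L = (\<Prod>\<delta>=1..d. M \<delta>)"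
  define w where "w x = fst (apply_alg d X \<omega> M \<Psi> (\<lambda>y. g (y(Suc d := x))))" for x
  have w: "w x = vec L (\<lambda>i. \<Sum>y\<in>grid d X. tensor_weight d \<omega> y * g (y(Suc d := x)) *
      tensor_fun d M \<Psi> i y)" for x
    unfolding w_def L_def by (rule Suc.IH) (use Suc.prems in auto)
  have dim_w: "dim_vec (w x) = L" for x by (simp add: w)
  let ?f = "\<lambda>x v. cbind (apply_alg d X \<omega> M \<Psi> (\<lambda>y. g (y(Suc d := x))))
          (\<lambda>w. add_point (\<omega> (Suc d) x) (\<lambda>m. \<Psi> (Suc d) m x) (M (Suc d)) w v)"
  have f: "fst (?f x v) =
      fst (add_point (\<omega> (Suc d) x) (\<lambda>m. \<Psi> (Suc d) m x) (M (Suc d)) (w x) v)" for x v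
    by (simp add: w_def)
  have dim_f: "dim_vec (fst (?f x v)) = dim_vec v" for x v by simp
  have LM: "(\<Prod>\<delta>=1..Suc d. M \<delta>) = M (Suc d) * L" by (simp add: L_def)
  show ?case
  proof (rule eq_vecI)
    show dim: "dim_vec (fst (apply_alg (Suc d) X \<omega> M \<Psi> g)) =
      dim_vec (vec (\<Prod>\<delta>=1..Suc d. M \<delta>) (\<lambda>i. \<Sum>x\<in>grid (Suc d) X.
        tensor_weight (Suc d) \<omega> x * g x * tensor_fun (Suc d) M \<Psi> i x))"
      unfolding apply_alg_Suc dim_cloop[of ?f, OF dim_f] by simp
    fix i
    assume "i < dim_vec (vec (\<Prod>\<delta>=1..Suc d. M \<delta>) (\<lambda>i. \<Sum>x\<in>grid (Suc d) X.
        tensor_weight (Suc d) \<omega> x * g x * tensor_fun (Suc d) M \<Psi> i x))"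
    then have i: "i < (\<Prod>\<delta>=1..Suc d. M \<delta>)" by (simp only: dim_vec)
    then have "0 < L" unfolding LM by (cases L) auto
    then have iL: "i mod L < L" by simp
    let ?h = "\<lambda>x. \<omega> (Suc d) x * \<Psi> (Suc d) (i div L) x * w x $ (i mod L)"
    have "fst (cloop ?f xs v) $ i = v $ i + (\<Sum>x\<leftarrow>xs. ?h x)"
      if "dim_vec v = M (Suc d) * L" for xs v
    proof (rule index_cloop[OF dim_f _ that])
      fix x and v :: "real vec"
      assume "dim_vec v = M (Suc d) * L"
      moreover from this have "i < dim_vec v" using i unfolding LM by simp
      ultimately show "fst (?f x v) $ i = v $ i + ?h x"
        unfolding f by (subst index_add_point) (simp_all add: dim_w)
    qed
    from this[of "0\<^sub>v (\<Prod>\<delta>=1..Suc d. M \<delta>)" "sorted_list_of_set (X (Suc d))"]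
    have "fst (apply_alg (Suc d) X \<omega> M \<Psi> g) $ i = (\<Sum>x\<leftarrow>sorted_list_of_set (X (Suc d)). ?h x)"
      unfolding apply_alg_Suc using i by (simp add: LM[symmetric] del: prod.cl_ivl_Suc One_nat_def)
    also have "\<dots> = (\<Sum>x\<in>X (Suc d). ?h x)"
      using Suc.prems by (simp add: sum_list_distinct_conv_sum_set)
    also have "\<dots> = (\<Sum>x\<in>X (Suc d). \<Sum>y\<in>grid d X. tensor_weight (Suc d) \<omega> (y(Suc d := x)) *
        g (y(Suc d := x)) * tensor_fun (Suc d) M \<Psi> i (y(Suc d := x)))"
      using iL
      by (intro sum.cong refl)
        (simp add: w tensor_weight_Suc tensor_fun_Suc[OF i] L_def sum_distrib_left mult_ac
          del: prod.cl_ivl_Suc)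
    finally show "fst (apply_alg (Suc d) X \<omega> M \<Psi> g) $ i =
      vec (\<Prod>\<delta>=1..Suc d. M \<delta>) (\<lambda>i. \<Sum>x\<in>grid (Suc d) X.
        tensor_weight (Suc d) \<omega> x * g x * tensor_fun (Suc d) M \<Psi> i x) $ i"
      using i by (simp add: sum_grid_Suc del: prod.cl_ivl_Suc)
  qed
qed

lemma apply_alg_correct:
  assumes "\<forall>\<delta>\<in>{1..d}. finite (X \<delta>)"
    and "u \<in> carrier_vec (\<Prod>\<delta>=1..d. N \<delta>)"
  shows "fst (apply_alg d X \<omega> M \<Psi> (\<lambda>x. F x * lin_comb d N \<Phi> u x)) =
    sys_matrix d X \<omega> F N \<Phi> M \<Psi> *\<^sub>v u" (is "?l = ?r")
proof -
  define P where "P = (\<Prod>\<delta>=1..d. N \<delta>)"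
  have P: "dim_vec u = P" using assms(2) by (simp add: P_def)
  show ?thesis
  proof (rule eq_vecI)
    show "dim_vec ?l = dim_vec ?r" by (simp add: apply_alg_value[OF assms(1)] sys_matrix_def)
    fix i assume "i < dim_vec ?r"
    then have i: "i < (\<Prod>\<delta>=1..d. M \<delta>)" by (simp add: sys_matrix_def)
    let ?t = "\<lambda>x n. tensor_weight d \<omega> x * F x * tensor_fun d N \<Phi> n x * tensor_fun d M \<Psi> i x * u $ n"
    have "?l $ i = (\<Sum>x\<in>grid d X. \<Sum>n<P. ?t x n)"
      using i by (simp add: apply_alg_value[OF assms(1)] lin_comb_def P_def sum_distrib_left
          sum_distrib_right mult_ac)
    also have "\<dots> = (\<Sum>n<P. \<Sum>x\<in>grid d X. ?t x n)"
      by (rule sum.swap)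
    also have "\<dots> = ?r $ i"
      using i P by (simp add: sys_matrix_def quad_form_def scalar_prod_def P_def sum_distrib_right
          atLeast0LessThan)
    finally show "?l $ i = ?r $ i" .
  qed
qed

section \<open>The number of operations\<close>

lemma apply_alg_cost:
  assumes "\<forall>\<delta>\<in>{1..d}. finite (X \<delta>)"
  shows "snd (apply_alg d X \<omega> M \<Psi> g) =
    (\<Sum>i=1..d. (\<Sum>x\<in>X i. card {m. m < M i \<and> \<Psi> i m x \<noteq> 0}) *
       (\<Prod>\<delta>=Suc i..d. card (X \<delta>)) * (1 + 2 * (\<Prod>\<delta>=1..<i. M \<delta>)))"
  using assms
proof (induction d arbitrary: g)
  case 0
  show ?case by simp
next
  case (Suc d)
  let ?n = "\<lambda>i x. card {m. m < M i \<and> \<Psi> i m x \<noteq> 0}"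
  let ?L = "\<lambda>i. 1 + 2 * (\<Prod>\<delta>=1..<i. M \<delta>)"
  let ?c = "\<lambda>d. \<Sum>i=1..d. (\<Sum>x\<in>X i. ?n i x) * (\<Prod>\<delta>=Suc i..d. card (X \<delta>)) * ?L i"
  have fin: "\<forall>\<delta>\<in>{1..d}. finite (X \<delta>)" using Suc.prems by simp
  have IH: "snd (apply_alg d X \<omega> M \<Psi> g) = ?c d" for g
    by (rule Suc.IH[OF fin])
  have "snd (apply_alg (Suc d) X \<omega> M \<Psi> g) =
      (\<Sum>x\<leftarrow>sorted_list_of_set (X (Suc d)). ?c d + ?n (Suc d) x * ?L (Suc d))"
    unfolding apply_alg_Suc
    by (rule snd_cloop)
      (simp add: IH snd_add_point apply_alg_value[OF fin] atLeastLessThanSuc_atLeastAtMost)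
  also have "\<dots> = (\<Sum>x\<in>X (Suc d). ?c d + ?n (Suc d) x * ?L (Suc d))"
    using Suc.prems by (simp add: sum_list_distinct_conv_sum_set)
  also have "\<dots> = ?c d * card (X (Suc d)) + (\<Sum>x\<in>X (Suc d). ?n (Suc d) x) * ?L (Suc d)"
    unfolding sum.distrib sum_distrib_right[of "?n (Suc d)" "X (Suc d)"]
    by (simp only: sum_constant of_nat_id mult.commute)
  also have "?c d * card (X (Suc d)) =
      (\<Sum>i=1..d. (\<Sum>x\<in>X i. ?n i x) * (\<Prod>\<delta>=Suc i..Suc d. card (X \<delta>)) * ?L i)"
    unfolding sum_distrib_right by (intro sum.cong refl) (simp add: mult_ac)
  finally show ?case by simp
qed

definition work :: "nat \<Rightarrow> (nat \<Rightarrow> real set) \<Rightarrow> (nat \<Rightarrow> nat) \<Rightarrow> (nat \<Rightarrow> nat) \<Rightarrow> nat" where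
  "work d X M q = (\<Sum>i=1..d. q i * (\<Prod>\<delta>=i..d. card (X \<delta>)) * (\<Prod>\<delta>=1..<i. M \<delta>))"

lemma mem_csupp: "\<phi> x \<noteq> 0 \<Longrightarrow> x \<in> csupp \<phi>"
  unfolding csupp_def by (rule CollectI, rule exI[of _ 1]) auto

lemma card_nonzero_le_overlap:
  assumes "finite S" and "x \<in> S"
  shows "card {m. m < K \<and> \<phi> m x \<noteq> 0} \<le> overlap S K \<phi>"
proof -
  have "card {m. m < K \<and> \<phi> m x \<noteq> 0} \<le> card {m. m < K \<and> x \<in> csupp (\<phi> m)}"
    by (rule card_mono) (auto intro: mem_csupp)
  also have "\<dots> \<le> overlap S K \<phi>"
    unfolding overlap_def using assms by (intro Max_ge) auto
  finally show ?thesis .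
qed

lemma overlap_le:
  assumes "finite S" and "S \<noteq> {}"
  shows "overlap S K \<phi> \<le> K"
proof -
  have "card {k. k < K \<and> x \<in> csupp (\<phi> k)} \<le> K" for x
    using card_mono[of "{..<K}" "{k. k < K \<and> x \<in> csupp (\<phi> k)}"] by auto
  then show ?thesis unfolding overlap_def using assms by simp
qed

lemma apply_alg_cost_le:
  assumes "admissible d X N M"
    and "\<And>\<delta>. \<delta> \<in> {1..d} \<Longrightarrow> overlap (X \<delta>) (M \<delta>) (\<Psi> \<delta>) = q \<delta>"
  shows "snd (apply_alg d X \<omega> M \<Psi> g) \<le> 3 * work d X M q"
proof -
  have fin: "\<forall>\<delta>\<in>{1..d}. finite (X \<delta>)" using assms(1) by (simp add: admissible_def)
  show ?thesis
    unfolding apply_alg_cost[OF fin] work_def sum_distrib_left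
  proof (rule sum_mono)
    fix i assume i: "i \<in> {1..d}"
    have "(\<Sum>x\<in>X i. card {m. m < M i \<and> \<Psi> i m x \<noteq> 0}) \<le> (\<Sum>x\<in>X i. q i)"
      using card_nonzero_le_overlap[OF bspec[OF fin i], of _ "M i" "\<Psi> i"]
      unfolding assms(2)[OF i] by (intro sum_mono) simp
    then have 1: "(\<Sum>x\<in>X i. card {m. m < M i \<and> \<Psi> i m x \<noteq> 0}) \<le> card (X i) * q i" by simp
    have "1 \<le> (\<Prod>\<delta>=1..<i. M \<delta>)"
      using assms(1) i by (intro prod_ge_1) (auto simp: admissible_def)
    then have 2: "1 + 2 * (\<Prod>\<delta>=1..<i. M \<delta>) \<le> 3 * (\<Prod>\<delta>=1..<i. M \<delta>)" by simp
    have 3: "(\<Prod>\<delta>=i..d. card (X \<delta>)) = card (X i) * (\<Prod>\<delta>=Suc i..d. card (X \<delta>))"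
      using i by (simp add: prod.atLeast_Suc_atMost)
    show "(\<Sum>x\<in>X i. card {m. m < M i \<and> \<Psi> i m x \<noteq> 0}) *
       (\<Prod>\<delta>=Suc i..d. card (X \<delta>)) * (1 + 2 * (\<Prod>\<delta>=1..<i. M \<delta>))
       \<le> 3 * (q i * (\<Prod>\<delta>=i..d. card (X \<delta>)) * (\<Prod>\<delta>=1..<i. M \<delta>))"
      using mult_le_mono[OF mult_le_mono1[OF 1, of "\<Prod>\<delta>=Suc i..d. card (X \<delta>)"] 2]
      unfolding 3 by (simp add: mult_ac)
  qed
qed

lemma cost_set_bound:
  assumes "admissible d X N M"
    and "r \<in> {snd (apply_alg d X \<omega> M \<Psi> g) |\<omega> \<Psi> g.
            \<forall>\<delta>\<in>{1..d}. overlap (X \<delta>) (M \<delta>) (\<Psi> \<delta>) = q \<delta>}"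
  shows "r \<le> 3 * work d X M q"
proof -
  from assms(2) obtain \<omega> \<Psi> g where "r = snd (apply_alg d X \<omega> M \<Psi> g)"
    and "\<forall>\<delta>\<in>{1..d}. overlap (X \<delta>) (M \<delta>) (\<Psi> \<delta>) = q \<delta>"
    by auto
  then show ?thesis using apply_alg_cost_le[OF assms(1), of \<Psi> q \<omega> g] by simp
qed

lemma cost_app_upper:
  assumes "admissible d X N M"
    and "\<And>\<delta>. \<delta> \<in> {1..d} \<Longrightarrow> overlap (X \<delta>) (M \<delta>) (\<Psi> \<delta>) = q \<delta>"
  shows "snd (apply_alg d X \<omega> M \<Psi> g) \<le> cost_app d X M q"
  unfolding cost_app_def
proof (rule cSup_upper)
  show "bdd_above {snd (apply_alg d X \<omega> M \<Psi> g) |\<omega> \<Psi> g.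
      \<forall>\<delta>\<in>{1..d}. overlap (X \<delta>) (M \<delta>) (\<Psi> \<delta>) = q \<delta>}"
    by (rule bdd_aboveI, erule cost_set_bound[OF assms(1)])
qed (use assms(2) in blast)

lemma cost_app_le:
  assumes "admissible d X N M"
  shows "cost_app d X M (\<lambda>\<delta>. overlap (X \<delta>) (M \<delta>) (\<Psi> \<delta>))
    \<le> 3 * work d X M (\<lambda>\<delta>. overlap (X \<delta>) (M \<delta>) (\<Psi> \<delta>))"
  unfolding cost_app_def
  by (rule cSup_least) (blast, erule cost_set_bound[OF assms])

text \<open>
  In this family the convex support of a member is either everything or empty, so at each point
  exactly \<open>k\<close> members are nonzero. The bound \<open>card_nonzero_le_overlap\<close> is thus attained at
  all points simultaneously, which makes these families the worst case.
\<close>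

lemma overlap_ones:
  assumes "finite S" and "S \<noteq> {}" and "k \<le> K"
  shows "overlap S K (\<lambda>m x. if m < k then 1 else 0) = k"
proof -
  let ?f = "\<lambda>(m :: nat) (x :: real). if m < k then 1 else 0 :: real"
  have csupp_ones: "x \<in> csupp (?f m) \<longleftrightarrow> m < k" for x m
    using mem_csupp[of "?f m" x] by (auto simp: csupp_def)
  have "{m. m < K \<and> x \<in> csupp (?f m)} = {..<k}" for x
    unfolding csupp_ones using assms(3) by auto
  then have "(\<lambda>x. card {m. m < K \<and> x \<in> csupp (?f m)}) ` S = (\<lambda>x. k) ` S"
    by (simp only: card_lessThan)
  also have "\<dots> = {k}"
    using assms(2) by auto
  finally show ?thesis unfolding overlap_def by simp
qed

lemma cost_app_ge:
  assumes "admissible d X N M" and "\<And>\<delta>. \<delta> \<in> {1..d} \<Longrightarrow> q \<delta> \<le> M \<delta>"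
  shows "2 * work d X M q \<le> cost_app d X M q"
proof -
  let ?\<Psi> = "\<lambda>\<delta> m x. if m < q \<delta> then 1 else 0 :: real"
  have fin: "\<forall>\<delta>\<in>{1..d}. finite (X \<delta>)" using assms(1) by (simp add: admissible_def)
  have "2 * work d X M q \<le> snd (apply_alg d X (\<lambda>_ _. 0) M ?\<Psi> (\<lambda>_. 0))"
    unfolding apply_alg_cost[OF fin] work_def sum_distrib_left
  proof (rule sum_mono)
    fix i assume i: "i \<in> {1..d}"
    have "{m. m < M i \<and> ?\<Psi> i m x \<noteq> 0} = {..<q i}" for x
      using assms(2)[OF i] by auto
    then have 1: "(\<Sum>x\<in>X i. card {m. m < M i \<and> ?\<Psi> i m x \<noteq> 0}) = card (X i) * q i" by simp
    have 2: "(\<Prod>\<delta>=i..d. card (X \<delta>)) = card (X i) * (\<Prod>\<delta>=Suc i..d. card (X \<delta>))"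
      using i by (simp add: prod.atLeast_Suc_atMost)
    show "2 * (q i * (\<Prod>\<delta>=i..d. card (X \<delta>)) * (\<Prod>\<delta>=1..<i. M \<delta>)) \<le>
       (\<Sum>x\<in>X i. card {m. m < M i \<and> ?\<Psi> i m x \<noteq> 0}) *
       (\<Prod>\<delta>=Suc i..d. card (X \<delta>)) * (1 + 2 * (\<Prod>\<delta>=1..<i. M \<delta>))"
      unfolding 1 2 by (simp add: algebra_simps)
  qed
  also have "\<dots> \<le> cost_app d X M q"
    by (rule cost_app_upper[OF assms(1)])
      (use assms in \<open>auto simp: admissible_def intro!: overlap_ones\<close>)
  finally show ?thesis .
qed

section \<open>Estimates of the sum\<close>

lemma prod_switch_le:
  fixes a b B :: "nat \<Rightarrow> 'a::linordered_semidom"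
  assumes "i \<in> {1..d}"
    and "\<And>\<delta>. \<delta> \<in> {i..d} \<Longrightarrow> 0 \<le> a \<delta> \<and> a \<delta> \<le> B \<delta>"
    and "\<And>\<delta>. \<delta> \<in> {1..<i} \<Longrightarrow> 0 \<le> b \<delta> \<and> b \<delta> \<le> B \<delta>"
  shows "(\<Prod>\<delta>=i..d. a \<delta>) * (\<Prod>\<delta>=1..<i. b \<delta>) \<le> (\<Prod>\<delta>=1..d. B \<delta>)"
proof -
  have "{1..d} = {i..d} \<union> {1..<i}" using assms(1) by auto
  then have "(\<Prod>\<delta>=1..d. B \<delta>) = (\<Prod>\<delta>=i..d. B \<delta>) * (\<Prod>\<delta>=1..<i. B \<delta>)"
    by (subst \<open>{1..d} = _\<close>, subst prod.union_disjoint) auto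
  moreover have "(\<Prod>\<delta>=i..d. a \<delta>) * (\<Prod>\<delta>=1..<i. b \<delta>) \<le> (\<Prod>\<delta>=i..d. B \<delta>) * (\<Prod>\<delta>=1..<i. B \<delta>)"
    using assms(2,3) by (intro mult_mono prod_mono prod_nonneg) (auto intro: order_trans)
  ultimately show ?thesis by simp
qed

lemma work_le_max:
  assumes "1 \<le> d"
  shows "work d X M q \<le> (\<Sum>i=1..d. q i * card (X d) * (\<Prod>\<delta>=1..<d. max (card (X \<delta>)) (M \<delta>)))"
  unfolding work_def
proof (rule sum_mono)
  fix i assume i: "i \<in> {1..d}"
  \<comment> \<open>No summand has the factor \<open>M d\<close>, so the bound in the last direction is \<open>card (X d)\<close>.\<close>
  let ?B = "\<lambda>\<delta>. if \<delta> = d then card (X d) else max (card (X \<delta>)) (M \<delta>)"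
  have "(\<Prod>\<delta>=i..d. card (X \<delta>)) * (\<Prod>\<delta>=1..<i. M \<delta>) \<le> (\<Prod>\<delta>=1..d. ?B \<delta>)"
    by (rule prod_switch_le) (use i in auto)
  also have "{1..d} = insert d {1..<d}" using assms by auto
  also have "prod ?B (insert d {1..<d}) = card (X d) * (\<Prod>\<delta>=1..<d. max (card (X \<delta>)) (M \<delta>))"
    by simp
  finally show "q i * (\<Prod>\<delta>=i..d. card (X \<delta>)) * (\<Prod>\<delta>=1..<i. M \<delta>) \<le>
      q i * card (X d) * (\<Prod>\<delta>=1..<d. max (card (X \<delta>)) (M \<delta>))"
    by (metis mult.assoc mult_le_mono2)
qed

lemma work_le_uniform:
  fixes b :: "nat \<Rightarrow> real"
  assumes "\<And>\<delta>. \<delta> \<in> {1..d} \<Longrightarrow> q \<delta> \<le> p"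
    and "\<And>\<delta>. \<delta> \<in> {1..d} \<Longrightarrow> real (card (X \<delta>)) \<le> k * b \<delta>"
    and "\<And>\<delta>. \<delta> \<in> {1..d} \<Longrightarrow> real (M \<delta>) \<le> k * b \<delta>"
  shows "real (work d X M q) \<le> real d * k ^ d * (real p * (\<Prod>\<delta>=1..d. b \<delta>))"
proof -
  have "real (work d X M q) \<le> (\<Sum>i=1..d. real p * (\<Prod>\<delta>=1..d. k * b \<delta>))"
    unfolding work_def of_nat_sum
  proof (rule sum_mono)
    fix i assume i: "i \<in> {1..d}"
    have "(\<Prod>\<delta>=i..d. real (card (X \<delta>))) * (\<Prod>\<delta>=1..<i. real (M \<delta>)) \<le> (\<Prod>\<delta>=1..d. k * b \<delta>)"
      by (rule prod_switch_le) (use i assms in auto)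
    then have "real (q i) * ((\<Prod>\<delta>=i..d. real (card (X \<delta>))) * (\<Prod>\<delta>=1..<i. real (M \<delta>)))
        \<le> real p * (\<Prod>\<delta>=1..d. k * b \<delta>)"
      using assms(1)[OF i] by (intro mult_mono) (auto intro!: mult_nonneg_nonneg prod_nonneg)
    then show "real (q i * (\<Prod>\<delta>=i..d. card (X \<delta>)) * (\<Prod>\<delta>=1..<i. M \<delta>))
        \<le> real p * (\<Prod>\<delta>=1..d. k * b \<delta>)"
      by (simp add: mult.assoc)
  qed
  then show ?thesis by (simp add: prod.distrib mult_ac)
qed

lemma overlap_le_max_overlap:
  assumes "\<delta> \<in> {1..d}"
  shows "overlap (X \<delta>) (M \<delta>) (\<Psi> \<delta>) \<le> max_overlap d X N \<Phi> M \<Psi>"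
  unfolding max_overlap_def using assms by (intro Max_ge) auto

lemma cost_app_le_uniform:
  fixes b :: "nat \<Rightarrow> real" and \<Phi> :: "nat \<Rightarrow> nat \<Rightarrow> real \<Rightarrow> real"
  assumes "admissible d X N M"
    and "\<And>\<delta>. \<delta> \<in> {1..d} \<Longrightarrow> real (card (X \<delta>)) \<le> k * b \<delta>"
    and "\<And>\<delta>. \<delta> \<in> {1..d} \<Longrightarrow> real (M \<delta>) \<le> k * b \<delta>"
  shows "real (cost_app d X M (\<lambda>\<delta>. overlap (X \<delta>) (M \<delta>) (\<Psi> \<delta>)))
    \<le> 3 * real d * k ^ d * (real (max_overlap d X N \<Phi> M \<Psi>) * (\<Prod>\<delta>=1..d. b \<delta>))"
proof -
  let ?q = "\<lambda>\<delta>. overlap (X \<delta>) (M \<delta>) (\<Psi> \<delta>)"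
  have "real (work d X M ?q)
      \<le> real d * k ^ d * (real (max_overlap d X N \<Phi> M \<Psi>) * (\<Prod>\<delta>=1..d. b \<delta>))"
    by (rule work_le_uniform) (use assms overlap_le_max_overlap in auto)
  then show ?thesis
    using cost_app_le[OF assms(1), of \<Psi>] by linarith
qed

lemma card_grid:
  shows "card (grid d X) = (\<Prod>\<delta>=1..d. card (X \<delta>))"
  unfolding grid_def by (simp add: card_PiE)


theorem mainTheorem2:
  fixes d :: nat
  assumes "1 \<le> d"
  shows
    "(\<exists>c>0. \<exists>C>0. \<forall>X \<omega> N \<Phi> M \<Psi> F u.
        admissible d X N M \<longrightarrow> u \<in> carrier_vec (\<Prod>\<delta>=1..d. N \<delta>) \<longrightarrow>
        (let q = (\<lambda>\<delta>. overlap (X \<delta>) (M \<delta>) (\<Psi> \<delta>));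
             run = apply_alg d X \<omega> M \<Psi> (\<lambda>x. F x * lin_comb d N \<Phi> u x);
             S = (\<Sum>i=1..d. q i * (\<Prod>\<delta>=i..d. card (X \<delta>)) * (\<Prod>\<delta>=1..<i. M \<delta>))
         in fst run = sys_matrix d X \<omega> F N \<Phi> M \<Psi> *\<^sub>v u \<and>
            snd run \<le> cost_app d X M q \<and>
            c * real S \<le> real (cost_app d X M q) \<and>
            real (cost_app d X M q) \<le> C * real S \<and>
            S \<le> (\<Sum>i=1..d. q i * card (X d) * (\<Prod>\<delta>=1..<d. max (card (X \<delta>)) (M \<delta>)))))
     \<and>
     (\<forall>K>0. \<exists>C>0. \<forall>X N \<Phi> M \<Psi>.
        admissible d X N M \<longrightarrow>
        (let q = (\<lambda>\<delta>. overlap (X \<delta>) (M \<delta>) (\<Psi> \<delta>)); p = max_overlap d X N \<Phi> M \<Psi>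
         in (\<forall>\<delta>\<in>{1..d}. real (card (X \<delta>)) \<le> K * (real p * real (M \<delta>))) \<longrightarrow>
            real (cost_app d X M q) \<le> C * (real p ^ (d + 1) * real (\<Prod>\<delta>=1..d. M \<delta>))))
     \<and>
     (\<forall>K>0. \<exists>C>0. \<forall>X N \<Phi> M \<Psi>.
        admissible d X N M \<longrightarrow>
        (let q = (\<lambda>\<delta>. overlap (X \<delta>) (M \<delta>) (\<Psi> \<delta>)); p = max_overlap d X N \<Phi> M \<Psi>
         in (\<forall>\<delta>\<in>{1..d}. real (card (X \<delta>)) \<le> K * real (M \<delta>)) \<longrightarrow>
            real (cost_app d X M q) \<le> C * (real p * real (\<Prod>\<delta>=1..d. M \<delta>))))
     \<and>
     (\<forall>K>0. \<exists>C>0. \<forall>X N \<Phi> M \<Psi>.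
        admissible d X N M \<longrightarrow>
        (let q = (\<lambda>\<delta>. overlap (X \<delta>) (M \<delta>) (\<Psi> \<delta>)); p = max_overlap d X N \<Phi> M \<Psi>
         in (\<forall>\<delta>\<in>{1..d}. real (M \<delta>) \<le> K * real (card (X \<delta>))) \<longrightarrow>
            real (cost_app d X M q) \<le> C * (real p * real (card (grid d X)))))"
proof (intro conjI, goal_cases)
  case 1
  show ?case
  proof (rule exI[of _ "2 :: real"], intro exI[of _ "3 :: real"] conjI allI impI, goal_cases)
    case (3 X \<omega> N \<Phi> M \<Psi> F u)
    then have fin: "\<forall>\<delta>\<in>{1..d}. finite (X \<delta>)" by (simp add: admissible_def)
    let ?q = "\<lambda>\<delta>. overlap (X \<delta>) (M \<delta>) (\<Psi> \<delta>)"
    have "2 * work d X M ?q \<le> cost_app d X M ?q"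
      using 3 by (intro cost_app_ge) (auto simp: admissible_def intro!: overlap_le)
    then show ?case
      using apply_alg_correct[OF fin 3(2)] cost_app_upper[OF 3(1) refl, where \<Psi> = \<Psi>]
        cost_app_le[OF 3(1), where \<Psi> = \<Psi>] work_le_max[OF assms, of X M ?q]
      unfolding Let_def work_def[symmetric] by auto
  qed simp_all
next
  case 2
  show ?case
  proof (intro allI impI, goal_cases)
    case (1 K)
    show ?case
    proof (intro exI[of _ "3 * real d * max 1 K ^ d"] conjI allI impI, goal_cases)
      case 1
      show ?case using assms by simp
    next
      case (2 X N \<Phi> M \<Psi>)
      define p where "p = max_overlap d X N \<Phi> M \<Psi>"
      show ?case
        unfolding Let_def p_def[symmetric]
      proof (intro impI)
        assume le: "\<forall>\<delta>\<in>{1..d}. real (card (X \<delta>)) \<le> K * (real p * real (M \<delta>))"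
        have X1: "1 \<le> card (X \<delta>)" if "\<delta> \<in> {1..d}" for \<delta>
          using 2 that by (auto simp: admissible_def Suc_le_eq card_gt_0_iff)
        \<comment> \<open>The grid has points, so the hypothesis excludes \<open>p = 0\<close>.\<close>
        have p: "1 \<le> p"
          using le X1[of 1] assms by (cases p) auto
        have X: "real (card (X \<delta>)) \<le> max 1 K * (real p * real (M \<delta>))" if "\<delta> \<in> {1..d}" for \<delta>
          using le that by (meson max.cobounded2 mult_right_mono of_nat_0_le_iff order_trans
              mult_nonneg_nonneg)
        have M: "real (M \<delta>) \<le> max 1 K * (real p * real (M \<delta>))" for \<delta>
        proof -
          have "1 * (1 * real (M \<delta>)) \<le> max 1 K * (real p * real (M \<delta>))"
            using p by (intro mult_mono) auto
          then show ?thesis by simp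
        qed
        show "real (cost_app d X M (\<lambda>\<delta>. overlap (X \<delta>) (M \<delta>) (\<Psi> \<delta>)))
          \<le> 3 * real d * max 1 K ^ d * (real p ^ (d + 1) * real (\<Prod>\<delta>=1..d. M \<delta>))"
          using cost_app_le_uniform[OF 2 X M, where \<Psi> = \<Psi> and \<Phi> = \<Phi>]
          unfolding p_def[symmetric] by (simp add: prod.distrib mult_ac)
      qed
    qed
  qed
next
  case 3
  show ?case
  proof (intro allI impI, goal_cases)
    case (1 K)
    show ?case
    proof (intro exI[of _ "3 * real d * max 1 K ^ d"] conjI allI impI, goal_cases)
      case 1
      show ?case using assms by simp
    next
      case (2 X N \<Phi> M \<Psi>)
      show ?case
        unfolding Let_def
      proof (intro impI)
        assume le: "\<forall>\<delta>\<in>{1..d}. real (card (X \<delta>)) \<le> K * real (M \<delta>)"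
        have X: "real (card (X \<delta>)) \<le> max 1 K * real (M \<delta>)" if "\<delta> \<in> {1..d}" for \<delta>
          using le that by (meson max.cobounded2 mult_right_mono of_nat_0_le_iff order_trans)
        have M: "real (M \<delta>) \<le> max 1 K * real (M \<delta>)" for \<delta>
          using mult_right_mono[of 1 "max 1 K" "real (M \<delta>)"] by simp
        show "real (cost_app d X M (\<lambda>\<delta>. overlap (X \<delta>) (M \<delta>) (\<Psi> \<delta>)))
          \<le> 3 * real d * max 1 K ^ d *
            (real (max_overlap d X N \<Phi> M \<Psi>) * real (\<Prod>\<delta>=1..d. M \<delta>))"
          using cost_app_le_uniform[OF 2 X M, where \<Psi> = \<Psi> and \<Phi> = \<Phi>] by simp
      qed
    qed
  qed
next
  case 4
  show ?case
  proof (intro allI impI, goal_cases)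
    case (1 K)
    show ?case
    proof (intro exI[of _ "3 * real d * max 1 K ^ d"] conjI allI impI, goal_cases)
      case 1
      show ?case using assms by simp
    next
      case (2 X N \<Phi> M \<Psi>)
      show ?case
        unfolding Let_def
      proof (intro impI)
        assume le: "\<forall>\<delta>\<in>{1..d}. real (M \<delta>) \<le> K * real (card (X \<delta>))"
        have M: "real (M \<delta>) \<le> max 1 K * real (card (X \<delta>))" if "\<delta> \<in> {1..d}" for \<delta>
          using le that by (meson max.cobounded2 mult_right_mono of_nat_0_le_iff order_trans)
        have X: "real (card (X \<delta>)) \<le> max 1 K * real (card (X \<delta>))" for \<delta>
          using mult_right_mono[of 1 "max 1 K" "real (card (X \<delta>))"] by simp
        show "real (cost_app d X M (\<lambda>\<delta>. overlap (X \<delta>) (M \<delta>) (\<Psi> \<delta>)))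
          \<le> 3 * real d * max 1 K ^ d *
            (real (max_overlap d X N \<Phi> M \<Psi>) * real (card (grid d X)))"
          using cost_app_le_uniform[OF 2 X M, where \<Psi> = \<Psi> and \<Phi> = \<Phi>] by (simp add: card_grid)
      qed
    qed
  qed
qed

end
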